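(* Let $N \geq 2$ be an integer, and put $B(2) = 7 = \frac{(N+1)(N+2)}{2}+1$ if $N=2$, and $B(N) = \frac{(N+1)(N+2)}{2} + \left\lfloor \frac{N-1}{2}\right\rfloor$ if $N \geq 3$. Then for every integer $n$ with $1 \leq n \leq B(N)$ there is an infinite family of degree two polynomial maps $\phi:\mathbb{P}^N \to \mathbb{P}^N$ defined over $\mathbb{Q}$, each of which has a $\mathbb{Q}$-rational periodic point of primitive period $n$. Moreover, the dimension of the family is at least $N$.
   Context: A polynomial map $\phi:\mathbb{P}^N \to \mathbb{P}^N$ of degree $d$, in coordinates $[x_0,\ldots,x_N]$, is a (rational) map of the form $\phi(x_0,\ldots,x_N) = [\phi_0(x_0,\ldots,x_N),\ldots,\phi_{N-1}(x_0,\ldots,x_N),x_N^d]$, where each $\phi_i$ is a homogeneous form of degree $d$ in $x_0,\ldots,x_N$; it is defined over $\mathbb{Q}$ if the $\phi_i$ have rational coefficients. It need not be a morphism. $\phi^n$ denotes the $n$-th iterate of $\phi$. A point $P$ (all of whose iterates under $\phi$ are defined) is periodic of period $n \geq 1$ if $\phi^n(P)=P$; the smallest such $n$ is the primitive period of $P$. A family of degree two polynomial maps over $\mathbb{Q}$ is a set of such maps, identified with the set of their coefficient vectors (the coefficients of $\phi_0,\ldots,\phi_{N-1}$) in affine space over $\mathbb{Q}$; its dimension is the dimension of the Zariski closure of this set (i.e. the number of independent rational parameters on which the family depends). $\lfloor x\rfloor$ is the greatest integer less than or equal to $x$. *)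

theory Defs
  imports
    "HOL-Library.Poly_Mapping"
    "HOL-Library.Extended_Nat"
    "HOL-Algebra.Ideal"
    "HOL-Analysis.Abstract_Topology"
begin

section \<open>Multivariate polynomials over the rationals\<close>

type_synonym 'v monomial = "'v \<Rightarrow>\<^sub>0 nat"
type_synonym 'v qpoly = "'v monomial \<Rightarrow>\<^sub>0 rat"

definition monomials_in :: "'v set \<Rightarrow> 'v monomial set" where
  "monomials_in V = {m. Poly_Mapping.keys m \<subseteq> V}"

definition mdegree :: "'v monomial \<Rightarrow> nat" where
  "mdegree m = (\<Sum>v\<in>Poly_Mapping.keys m. Poly_Mapping.lookup m v)"

definition meval :: "('v \<Rightarrow> rat) \<Rightarrow> 'v monomial \<Rightarrow> rat" where
  "meval x m = (\<Prod>v\<in>Poly_Mapping.keys m. x v ^ Poly_Mapping.lookup m v)"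

definition qeval :: "('v \<Rightarrow> rat) \<Rightarrow> 'v qpoly \<Rightarrow> rat" where
  "qeval x p = (\<Sum>m\<in>Poly_Mapping.keys p. Poly_Mapping.lookup p m * meval x m)"

lemma meval_sup:
  "finite A \<Longrightarrow> Poly_Mapping.keys m \<subseteq> A \<Longrightarrow> meval x m = (\<Prod>v\<in>A. x v ^ Poly_Mapping.lookup m v)"
  unfolding meval_def by (rule prod.mono_neutral_left) (auto simp: in_keys_iff)

lemma qeval_sup:
  "finite A \<Longrightarrow> Poly_Mapping.keys p \<subseteq> A \<Longrightarrow> qeval x p = (\<Sum>m\<in>A. Poly_Mapping.lookup p m * meval x m)"
  unfolding qeval_def by (rule sum.mono_neutral_left) (auto simp: in_keys_iff)

lemma meval_add: "meval x (m + m') = meval x m * meval x m'"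
proof -
  let ?A = "Poly_Mapping.keys m \<union> Poly_Mapping.keys m'"
  have "Poly_Mapping.keys (m+m') \<subseteq> ?A" by (rule Poly_Mapping.keys_add)
  then show ?thesis
    by (subst (1 2 3) meval_sup[of ?A]) (simp_all add: lookup_add power_add prod.distrib)
qed

lemma qeval_add: "qeval x (p + q) = qeval x p + qeval x q"
proof -
  let ?A = "Poly_Mapping.keys p \<union> Poly_Mapping.keys q"
  have "Poly_Mapping.keys (p+q) \<subseteq> ?A" by (rule Poly_Mapping.keys_add)
  then show ?thesis
    by (subst (1 2 3) qeval_sup[of ?A]) (simp_all add: lookup_add distrib_right sum.distrib)
qed

lemma qeval_single: "qeval x (Poly_Mapping.single m c) = c * meval x m"
  by (subst qeval_sup[of "{m}"]) (auto)

lemma qpoly_induct: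
  assumes "P 0" "\<And>p m c. P p \<Longrightarrow> P (Poly_Mapping.single m c + p)"
  shows "P (p :: 'v qpoly)"
proof (induction p rule: Poly_Mapping.update_induct)
  case (update f a b)
  have "Poly_Mapping.update a b f = Poly_Mapping.single a b + f"
    using update(1) by (intro poly_mapping_eqI) (auto simp: lookup_update lookup_add lookup_single in_keys_iff)
  then show ?case using assms(2) update by simp
qed (rule assms)

lemma qeval_zero: "qeval x 0 = 0" by (simp add: qeval_def)

lemma qeval_mult: "qeval x (p * q) = qeval x p * qeval x q"
proof (induction p rule: qpoly_induct)
  case (2 p m c)
  have "qeval x (Poly_Mapping.single m c * q) = c * meval x m * qeval x q"
  proof (induction q rule: qpoly_induct)
    case (2 q k d) then show ?case
      by (simp add: distrib_left qeval_add mult_single qeval_single meval_add)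
  qed (simp add: qeval_zero)
  then show ?case using 2 by (simp add: distrib_right qeval_add qeval_single)
qed (simp add: qeval_zero)

lemma qeval_one: "qeval x 1 = 1"
  by (simp add: qeval_def meval_def)

definition qpoly_ring :: "'v set \<Rightarrow> 'v qpoly ring" where
  "qpoly_ring V = \<lparr>carrier = {p. Poly_Mapping.keys p \<subseteq> monomials_in V},
     monoid.mult = (*), one = 1, zero = 0, add = (+)\<rparr>"

lemma cring_qpoly_ring: "cring (qpoly_ring V)"
proof (rule cringI)
  have add: "p + q \<in> carrier (qpoly_ring V)"
    if "p \<in> carrier (qpoly_ring V)" "q \<in> carrier (qpoly_ring V)" for p q
    using that Poly_Mapping.keys_add[of p q] by (auto simp: qpoly_ring_def)
  show "abelian_group (qpoly_ring V)"
  proof (rule abelian_groupI)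
    fix p assume "p \<in> carrier (qpoly_ring V)"
    then have "- p \<in> carrier (qpoly_ring V)" by (simp add: qpoly_ring_def)
    moreover have "- p \<oplus>\<^bsub>qpoly_ring V\<^esub> p = \<zero>\<^bsub>qpoly_ring V\<^esub>"
      by (simp add: qpoly_ring_def)
    ultimately show "\<exists>q\<in>carrier (qpoly_ring V). q \<oplus>\<^bsub>qpoly_ring V\<^esub> p = \<zero>\<^bsub>qpoly_ring V\<^esub>"
      by (rule bexI[rotated])
  qed (use add in \<open>simp_all add: qpoly_ring_def ac_simps\<close>)
  show "comm_monoid (qpoly_ring V)"
  proof (rule comm_monoidI)
    fix p q assume "p \<in> carrier (qpoly_ring V)" "q \<in> carrier (qpoly_ring V)"
    then have *: "Poly_Mapping.keys a \<subseteq> V" "Poly_Mapping.keys b \<subseteq> V"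
      if "a \<in> Poly_Mapping.keys p" "b \<in> Poly_Mapping.keys q" for a b
      using that by (auto simp: qpoly_ring_def monomials_in_def)
    have "Poly_Mapping.keys (a + b) \<subseteq> V"
      if "a \<in> Poly_Mapping.keys p" "b \<in> Poly_Mapping.keys q" for a b
      using Poly_Mapping.keys_add[of a b] *[OF that] by blast
    then show "p \<otimes>\<^bsub>qpoly_ring V\<^esub> q \<in> carrier (qpoly_ring V)"
      using Poly_Mapping.keys_mult[of p q] by (fastforce simp: qpoly_ring_def monomials_in_def)
  qed (simp_all add: qpoly_ring_def monomials_in_def ac_simps)
qed (simp add: qpoly_ring_def distrib_right)


section \<open>Affine space over the rationals and dimension\<close>

definition Spec :: "('a, 'b) ring_scheme \<Rightarrow> 'a set set" where
  "Spec R = {P. primeideal P R}"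

definition zariski :: "('a, 'b) ring_scheme \<Rightarrow> 'a set topology" where
  "zariski R = topology (\<lambda>U. \<exists>E\<subseteq>carrier R. U = {P \<in> Spec R. \<not> E \<subseteq> P})"

lemma Union_opens: "(\<Union>E\<in>\<F>. {P \<in> A. \<not> E \<subseteq> P}) = {P \<in> A. \<not> \<Union>\<F> \<subseteq> P}"
  by (simp only: Sup_le_iff) auto

lemma image_of_family:
  assumes "\<forall>K\<in>\<K>. \<exists>E\<subseteq>C. K = D E"
  shows "\<K> = D ` {E. E \<subseteq> C \<and> D E \<in> \<K>}"
  using assms by fast

lemma openin_zariski:
  "openin (zariski R) U \<longleftrightarrow> (\<exists>E\<subseteq>carrier R. U = {P \<in> Spec R. \<not> E \<subseteq> P})"
proof -
  let ?D = "\<lambda>E. {P \<in> Spec R. \<not> E \<subseteq> P}"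
  have "\<exists>G\<subseteq>carrier R. ?D E \<inter> ?D F = ?D G" if "E \<subseteq> carrier R" "F \<subseteq> carrier R" for E F
  proof (cases "Spec R = {}")
    case False
    then obtain P0 where "primeideal P0 R" by (auto simp: Spec_def)
    then interpret cring R by (rule primeideal.axioms(2))
    let ?G = "{e \<otimes>\<^bsub>R\<^esub> f | e f. e \<in> E \<and> f \<in> F}"
    have "?D E \<inter> ?D F = ?D ?G"
    proof (intro equalityI subsetI)
      fix P assume "P \<in> ?D E \<inter> ?D F"
      then obtain e f where P: "P \<in> Spec R" "e \<in> E" "f \<in> F" "e \<notin> P" "f \<notin> P" by auto
      then have "e \<otimes>\<^bsub>R\<^esub> f \<notin> P"
        using primeideal.I_prime[of P R e f] that by (auto simp: Spec_def)
      then show "P \<in> ?D ?G" using P by blast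
    next
      fix P assume "P \<in> ?D ?G"
      then obtain e f where P: "P \<in> Spec R" "e \<in> E" "f \<in> F" "e \<otimes>\<^bsub>R\<^esub> f \<notin> P" by auto
      then have "ideal P R" by (simp add: Spec_def primeideal_def)
      then have "e \<notin> P" "f \<notin> P"
        using P that ideal.I_l_closed[of P R f e] ideal.I_r_closed[of P R e f] by auto
      then show "P \<in> ?D E \<inter> ?D F" using P by auto
    qed
    moreover have "?G \<subseteq> carrier R" using that by auto
    ultimately show ?thesis by blast
  qed auto
  moreover have "\<exists>G\<subseteq>carrier R. \<Union>\<K> = ?D G"
    if "\<forall>K\<in>\<K>. \<exists>E\<subseteq>carrier R. K = ?D E" for \<K>
  proof -
    let ?F = "{E. E \<subseteq> carrier R \<and> ?D E \<in> \<K>}"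
    have "\<K> = ?D ` ?F" using that by (rule image_of_family)
    then have "\<Union>\<K> = (\<Union>E\<in>?F. ?D E)" by (rule arg_cong)
    also have "\<dots> = ?D (\<Union>?F)" by (rule Union_opens)
    finally have "\<Union>\<K> = ?D (\<Union>?F)" .
    moreover have "\<Union>?F \<subseteq> carrier R" by (intro Union_least) simp
    ultimately show ?thesis by (intro exI[of _ "\<Union>?F"] conjI)
  qed
  ultimately have "istopology (\<lambda>U. \<exists>E\<subseteq>carrier R. U = ?D E)"
    unfolding istopology_def by (intro conjI allI impI) (elim exE conjE, simp)+
  then show ?thesis by (simp add: zariski_def topology_inverse')
qed

definition irreducible_closed :: "'a topology \<Rightarrow> 'a set \<Rightarrow> bool" where
  "irreducible_closed X Z \<longleftrightarrow> closedin X Z \<and> Z \<noteq> {} \<and>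
     (\<forall>A B. closedin X A \<and> closedin X B \<and> Z = A \<union> B \<longrightarrow> Z = A \<or> Z = B)"

text \<open>The empty space gets dimension \<open>0\<close> here.\<close>

definition krull_dim :: "'a topology \<Rightarrow> enat" where
  "krull_dim X = Sup {enat k | k. \<exists>Z :: nat \<Rightarrow> 'a set.
     (\<forall>i\<le>k. irreducible_closed X (Z i)) \<and> (\<forall>i<k. Z i \<subset> Z (Suc i))}"

text \<open>
  Affine space with coordinates indexed by \<open>V\<close> is the prime spectrum of the polynomial ring,
  not merely the set of rational points: inside the set of rational points
  chains of irreducible closed subsets can be too short (e.g. when an abelian surface with
  Zariski-dense rational points contains no curve with infinitely many of them).
  A rational point \<open>c\<close> is the maximal ideal of polynomials vanishing at it.
\<close>

definition rational_point :: "'v set \<Rightarrow> ('v \<Rightarrow> rat) \<Rightarrow> 'v qpoly set" where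
  "rational_point V c = {p \<in> carrier (qpoly_ring V). qeval c p = 0}"

lemma rational_point_Spec: "rational_point V c \<in> Spec (qpoly_ring V)"
proof -
  let ?R = "qpoly_ring V"
  interpret cring ?R by (rule cring_qpoly_ring)
  have z: "\<zero>\<^bsub>?R\<^esub> = 0" "\<one>\<^bsub>?R\<^esub> = 1" "mult ?R = (*)" "add ?R = (+)" by (simp_all add: qpoly_ring_def)
  have inv: "qeval c (\<ominus>\<^bsub>?R\<^esub> p) = 0" if "p \<in> carrier ?R" "qeval c p = 0" for p
    using l_neg[OF that(1)] that(2) qeval_add[of c "\<ominus>\<^bsub>?R\<^esub> p" p] by (simp add: z qeval_zero)
  have "ideal (rational_point V c) ?R"
  proof (rule idealI)
    show "subgroup (rational_point V c) (add_monoid ?R)"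
      by (rule add.subgroupI)
        (use inv a_closed zero_closed in \<open>auto simp: rational_point_def qeval_add qeval_zero z simp flip: a_inv_def\<close>)
  qed (use m_closed ring_axioms in \<open>auto simp: rational_point_def qeval_mult z\<close>)
  then show ?thesis unfolding Spec_def mem_Collect_eq
  proof (rule primeidealI[OF _ is_cring])
    have "1 \<notin> rational_point V c" by (simp add: rational_point_def qeval_one)
    then show "carrier ?R \<noteq> rational_point V c" using one_closed z by auto
  qed (auto simp: rational_point_def qeval_mult z)
qed

lemma topspace_zariski_qpoly_ring:
  "topspace (zariski (qpoly_ring V)) = Spec (qpoly_ring V)"
proof -
  interpret cring "qpoly_ring V" by (rule cring_qpoly_ring)
  have "openin (zariski (qpoly_ring V)) (Spec (qpoly_ring V))"
    unfolding openin_zariski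
  proof (intro exI[of _ "{\<one>\<^bsub>qpoly_ring V\<^esub>}"] conjI)
    show "Spec (qpoly_ring V) = {P \<in> Spec (qpoly_ring V). \<not> {\<one>\<^bsub>qpoly_ring V\<^esub>} \<subseteq> P}"
      using ideal.one_imp_carrier primeideal.I_notcarr primeideal.axioms(1)
      unfolding Spec_def by fastforce
  qed (use one_closed in auto)
  moreover have "topspace (zariski (qpoly_ring V)) \<subseteq> Spec (qpoly_ring V)"
    using openin_topspace[of "zariski (qpoly_ring V)"] unfolding openin_zariski by blast
  ultimately show ?thesis using openin_subset by blast
qed

definition zariski_closure :: "'v set \<Rightarrow> ('v \<Rightarrow> rat) set \<Rightarrow> 'v qpoly set set" where
  "zariski_closure V S = zariski (qpoly_ring V) closure_of (rational_point V ` S)"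

definition zariski_dim :: "'v set \<Rightarrow> ('v \<Rightarrow> rat) set \<Rightarrow> enat" where
  "zariski_dim V S =
     krull_dim (subtopology (zariski (qpoly_ring V)) (zariski_closure V S))"


section \<open>Polynomial maps of projective space\<close>

definition form_monomials :: "nat \<Rightarrow> nat \<Rightarrow> nat monomial set" where
  "form_monomials N d = {m \<in> monomials_in {0..N}. mdegree m = d}"

text \<open>
  A map is given by its coordinate forms \<open>\<phi> 0, \<dots>, \<phi> N\<close>; since the last one is
  normalised, the forms are determined by the map. The values \<open>\<phi> i\<close> with \<open>i > N\<close>
  are fixed to \<open>0\<close>.
\<close>

definition polynomial_map :: "nat \<Rightarrow> nat \<Rightarrow> (nat \<Rightarrow> nat qpoly) \<Rightarrow> bool" where
  "polynomial_map N d \<phi> \<longleftrightarrow>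
     (\<forall>i<N. Poly_Mapping.keys (\<phi> i) \<subseteq> form_monomials N d) \<and>
     \<phi> N = Poly_Mapping.single (Poly_Mapping.single N d) 1 \<and>
     (\<forall>i>N. \<phi> i = 0)"

definition homogeneous_coords :: "nat \<Rightarrow> (nat \<Rightarrow> rat) set" where
  "homogeneous_coords N = {x. x \<noteq> (\<lambda>_. 0) \<and> (\<forall>i>N. x i = 0)}"

definition proj_point :: "(nat \<Rightarrow> rat) \<Rightarrow> (nat \<Rightarrow> rat) set" where
  "proj_point x = {\<lambda>i. c * x i | c. c \<noteq> 0}"

definition proj_space :: "nat \<Rightarrow> (nat \<Rightarrow> rat) set set" where
  "proj_space N = proj_point ` homogeneous_coords N"

text \<open>
  The graph of the partial map on rational points, defined where the
  coordinate forms do not all vanish.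
\<close>

definition proj_graph :: "nat \<Rightarrow> (nat \<Rightarrow> nat qpoly) \<Rightarrow> (nat \<Rightarrow> rat) set rel" where
  "proj_graph N \<phi> = {(proj_point x, proj_point (\<lambda>i. qeval x (\<phi> i))) | x.
     x \<in> homogeneous_coords N \<and> (\<lambda>i. qeval x (\<phi> i)) \<in> homogeneous_coords N}"

text \<open>
  For polynomial maps the graph is single-valued, so \<open>(P, P) \<in> proj_graph N \<phi> ^^ n\<close> with
  \<open>n \<ge> 1\<close> already entails that all iterates are defined at \<open>P\<close>.
\<close>

definition has_period :: "nat \<Rightarrow> (nat \<Rightarrow> nat qpoly) \<Rightarrow> (nat \<Rightarrow> rat) set \<Rightarrow> nat \<Rightarrow> bool" where
  "has_period N \<phi> P n \<longleftrightarrow> n \<ge> 1 \<and> (P, P) \<in> proj_graph N \<phi> ^^ n"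

definition primitive_period :: "nat \<Rightarrow> (nat \<Rightarrow> nat qpoly) \<Rightarrow> (nat \<Rightarrow> rat) set \<Rightarrow> nat \<Rightarrow> bool" where
  "primitive_period N \<phi> P n \<longleftrightarrow> has_period N \<phi> P n \<and> (\<forall>m<n. \<not> has_period N \<phi> P m)"

definition coeff_index :: "nat \<Rightarrow> nat \<Rightarrow> (nat \<times> nat monomial) set" where
  "coeff_index N d = {..<N} \<times> form_monomials N d"

definition coeff_vector :: "(nat \<Rightarrow> nat qpoly) \<Rightarrow> nat \<times> nat monomial \<Rightarrow> rat" where
  "coeff_vector \<phi> = (\<lambda>(i, m). Poly_Mapping.lookup (\<phi> i) m)"

definition family_dim :: "nat \<Rightarrow> nat \<Rightarrow> (nat \<Rightarrow> nat qpoly) set \<Rightarrow> enat" where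
  "family_dim N d F = zariski_dim (coeff_index N d) (coeff_vector ` F)"

definition period_bound :: "nat \<Rightarrow> nat" where
  "period_bound N = (if N = 2 then (N + 1) * (N + 2) div 2 + 1
     else (N + 1) * (N + 2) div 2 + (N - 1) div 2)"

end

theory Submission
  imports Defs "HOL-Computational_Algebra.Polynomial"
begin

text \<open>
  In the chart \<open>x\<^sub>N = 1\<close> a degree two polynomial map is an arbitrary quadratic self-map \<open>F\<close> of affine
  \<open>N\<close>-space. If an \<open>n\<close>-cycle of \<open>F\<close> lies on a quadric \<open>r = 0\<close>, then all the maps \<open>F + c r\<close> with
  \<open>c\<close> a rational vector have that cycle, and their coefficients form an affine-linear space of dimension \<open>N\<close>.
  So it suffices to find cycles lying on quadrics. Consider orbit segments, at whose last point some
  quadratic function \<open>q\<close> is nonzero, while \<open>q\<close> vanishes at all the earlier points: by adding a multiple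
  of \<open>q\<close>, the last point can be sent anywhere without changing the segment, so every tail of the
  segment can be closed to a cycle. Two further coordinates, a carry and a toggle, allow one to run
  through a segment of \<open>m\<close> points twice, which yields such a segment of \<open>2 m + 2\<close> points on a quadric.
  Starting with 7 points in the plane and 11 points in space, this gives all periods up to the bound
  if \<open>N \<ge> 4\<close>; dimensions two and three are settled by explicit maps.
\<close>

section \<open>Dimension of linear families\<close>

lemma meval_on_line: "\<exists>u. \<forall>t. poly u t = meval (\<lambda>v. a v + t * b v) m"
proof -
  have "poly (\<Prod>v\<in>Poly_Mapping.keys m. [:a v, b v:] ^ Poly_Mapping.lookup m v) t
      = meval (\<lambda>v. a v + t * b v) m" for t
    by (simp add: meval_def poly_prod)
  then show ?thesis by blast
qed

lemma qeval_on_line: "\<exists>u. \<forall>t. poly u t = qeval (\<lambda>v. a v + t * b v) p"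
proof -
  obtain u where u: "poly (u m) t = meval (\<lambda>v. a v + t * b v) m" for m t
    using meval_on_line[of a b] by metis
  have "poly (\<Sum>m\<in>Poly_Mapping.keys p. smult (Poly_Mapping.lookup p m) (u m)) t
      = qeval (\<lambda>v. a v + t * b v) p" for t
    by (simp add: qeval_def poly_sum u)
  then show ?thesis by blast
qed

text \<open>On the line that passes through \<open>a\<close> at \<open>t = 0\<close> and
  \<open>b\<close> at \<open>t = 1\<close>, both \<open>p\<close> and \<open>q\<close> become
  nonzero polynomials in \<open>t\<close>. Their product has finitely many roots, and the rationals
  are infinite.\<close>

lemma qeval_both_nonzero_on_line:
  assumes "qeval a p \<noteq> 0" and "qeval b q \<noteq> 0"
  obtains t where "qeval (\<lambda>v. a v + t * (b v - a v)) p \<noteq> 0"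
    and "qeval (\<lambda>v. a v + t * (b v - a v)) q \<noteq> 0"
proof -
  obtain u where u: "\<forall>t. poly u t = qeval (\<lambda>v. a v + t * (b v - a v)) p"
    using qeval_on_line[of a "\<lambda>v. b v - a v" p] by blast
  obtain w where w: "\<forall>t. poly w t = qeval (\<lambda>v. a v + t * (b v - a v)) q"
    using qeval_on_line[of a "\<lambda>v. b v - a v" q] by blast
  have "poly u 0 \<noteq> 0" "poly w 1 \<noteq> 0"
    using assms u w by simp_all
  then have "u * w \<noteq> 0" by auto
  then have "finite {t. poly (u * w) t = 0}" by (rule poly_roots_finite)
  then obtain t where "poly (u * w) t \<noteq> 0"
    using infinite_UNIV_char_0[where 'a = rat] by (metis (mono_tags) finite_subset mem_Collect_eq subsetI)
  with u w show ?thesis by (intro that[of t]) auto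
qed

section \<open>Irreducible closed sets and chains of linear subspaces\<close>

lemma closedin_zariski:
  "closedin (zariski (qpoly_ring V)) A \<longleftrightarrow>
    (\<exists>E\<subseteq>carrier (qpoly_ring V). A = {P \<in> Spec (qpoly_ring V). E \<subseteq> P})"
proof -
  let ?S = "Spec (qpoly_ring V)"
  have eq: "(A \<subseteq> ?S \<and> ?S - A = {P \<in> ?S. \<not> E \<subseteq> P}) \<longleftrightarrow> A = {P \<in> ?S. E \<subseteq> P}" for E
    by blast
  show ?thesis
    unfolding closedin_def topspace_zariski_qpoly_ring openin_zariski eq[symmetric] by blast
qed

lemma rational_point_in_closed:
  assumes "E \<subseteq> carrier (qpoly_ring V)"
  shows "rational_point V c \<in> {P \<in> Spec (qpoly_ring V). E \<subseteq> P} \<longleftrightarrow> (\<forall>p\<in>E. qeval c p = 0)"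
  using assms rational_point_Spec[of V c] by (auto simp: rational_point_def)

text \<open>A closed set that contains \<open>T\<close> contains its closure, so irreducibility of
  the closure can be tested on \<open>T\<close>.\<close>

lemma irreducible_closed_closure_of:
  assumes "T \<noteq> {}" "T \<subseteq> topspace X"
    and "\<And>A B. closedin X A \<Longrightarrow> closedin X B \<Longrightarrow> T \<subseteq> A \<union> B \<Longrightarrow> T \<subseteq> A \<or> T \<subseteq> B"
  shows "irreducible_closed X (X closure_of T)"
  unfolding irreducible_closed_def
proof (intro conjI allI impI)
  let ?Z = "X closure_of T"
  have sub: "T \<subseteq> ?Z" by (rule closure_of_subset[OF assms(2)])
  then show "?Z \<noteq> {}" using assms(1) by blast
  fix A B assume AB: "closedin X A \<and> closedin X B \<and> ?Z = A \<union> B"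
  then have "T \<subseteq> A \<or> T \<subseteq> B" using sub assms(3) by blast
  then have "?Z \<subseteq> A \<or> ?Z \<subseteq> B"
    using AB closure_of_minimal by metis
  then show "?Z = A \<or> ?Z = B" using AB by blast
qed simp

text \<open>If closed sets \<open>A\<close> and \<open>B\<close> both miss a point of
  \<open>S\<close>, say \<open>a\<close> and \<open>b\<close>, then some polynomial defining
  \<open>A\<close> is nonzero at \<open>a\<close> and one defining \<open>B\<close> is nonzero at
  \<open>b\<close>. Some point of the line through \<open>a\<close> and \<open>b\<close> is a zero
  of neither, so \<open>A\<close> and \<open>B\<close> do not cover \<open>S\<close>.\<close>

lemma irreducible_closed_line_closed:
  assumes "S \<noteq> {}"
    and "\<And>a b t. a \<in> S \<Longrightarrow> b \<in> S \<Longrightarrow> (\<lambda>v. a v + t * (b v - a v)) \<in> S"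
  shows "irreducible_closed (zariski (qpoly_ring V)) (zariski_closure V S)"
  unfolding zariski_closure_def
proof (rule irreducible_closed_closure_of)
  show "rational_point V ` S \<subseteq> topspace (zariski (qpoly_ring V))"
    by (auto simp: topspace_zariski_qpoly_ring rational_point_Spec)
  fix A B
  assume A: "closedin (zariski (qpoly_ring V)) A" and B: "closedin (zariski (qpoly_ring V)) B"
    and sub: "rational_point V ` S \<subseteq> A \<union> B"
  obtain E where E: "E \<subseteq> carrier (qpoly_ring V)" "A = {P \<in> Spec (qpoly_ring V). E \<subseteq> P}"
    using A unfolding closedin_zariski by blast
  obtain G where G: "G \<subseteq> carrier (qpoly_ring V)" "B = {P \<in> Spec (qpoly_ring V). G \<subseteq> P}"
    using B unfolding closedin_zariski by blast
  note inA = rational_point_in_closed[OF E(1), folded E(2)]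
  note inB = rational_point_in_closed[OF G(1), folded G(2)]
  show "rational_point V ` S \<subseteq> A \<or> rational_point V ` S \<subseteq> B"
  proof (rule ccontr)
    assume "\<not> ?thesis"
    then obtain a b where ab: "a \<in> S" "b \<in> S" "rational_point V a \<notin> A" "rational_point V b \<notin> B"
      by blast
    then obtain p q where pq: "p \<in> E" "q \<in> G" "qeval a p \<noteq> 0" "qeval b q \<noteq> 0"
      using inA inB by blast
    then obtain t where "qeval (\<lambda>v. a v + t * (b v - a v)) p \<noteq> 0"
        "qeval (\<lambda>v. a v + t * (b v - a v)) q \<noteq> 0"
      using qeval_both_nonzero_on_line by blast
    then have "rational_point V (\<lambda>v. a v + t * (b v - a v)) \<notin> A \<union> B"
      using inA inB pq(1,2) by blast
    then show False using assms(2)[OF ab(1,2)] sub by blast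
  qed
qed (use assms(1) in simp)

text \<open>The polynomial \<open>X_e - d\<close> vanishes on \<open>S\<close>, hence on its
  closure. This separates consecutive members of the chain in \<open>zariski_dim_ge\<close>.\<close>

lemma zariski_closure_subset_hyperplane:
  assumes "e \<in> V" "\<And>c. c \<in> S \<Longrightarrow> c e = d" "rational_point V c \<in> zariski_closure V S"
  shows "c e = d"
proof -
  let ?p = "Poly_Mapping.single (Poly_Mapping.single e 1) 1 + Poly_Mapping.single 0 (- d) :: _ qpoly"
  have ev: "qeval c ?p = c e - d" for c
    by (simp add: qeval_add qeval_single meval_def)
  have "Poly_Mapping.keys ?p \<subseteq> monomials_in V"
    using assms(1) by (intro subset_trans[OF Poly_Mapping.keys_add]) (auto simp: monomials_in_def)
  then have p: "{?p} \<subseteq> carrier (qpoly_ring V)" by (simp add: qpoly_ring_def)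
  let ?H = "{P \<in> Spec (qpoly_ring V). {?p} \<subseteq> P}"
  have "closedin (zariski (qpoly_ring V)) ?H" using p unfolding closedin_zariski by blast
  moreover have "rational_point V ` S \<subseteq> ?H"
    using rational_point_in_closed[OF p] assms(2) ev by (auto simp del: insert_subset)
  ultimately have "zariski_closure V S \<subseteq> ?H"
    unfolding zariski_closure_def by (intro closure_of_minimal)
  then have "rational_point V c \<in> ?H" using assms(3) by blast
  then have "qeval c ?p = 0" using rational_point_in_closed[OF p, of c] by blast
  then show ?thesis unfolding ev by simp
qed

lemma irreducible_closed_subtopology:
  assumes "irreducible_closed X Z" "Z \<subseteq> C" "closedin X C"
  shows "irreducible_closed (subtopology X C) Z"
  using assms unfolding irreducible_closed_def
  by (auto simp: closedin_closed_subtopology)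

text \<open>The closures of the affine subspaces through \<open>a\<close> spanned by the first
  \<open>k\<close> directions, for \<open>k = 0, ..., N\<close>, are irreducible and form a chain
  with \<open>N\<close> strict inclusions. The condition on \<open>e\<close> is triangularity: the
  first \<open>k\<close> directions leave coordinate \<open>e k\<close> fixed, and
  \<open>b k\<close> moves it.\<close>

lemma zariski_dim_ge:
  fixes a :: "'v \<Rightarrow> rat" and b :: "nat \<Rightarrow> 'v \<Rightarrow> rat" and e :: "nat \<Rightarrow> 'v"
  assumes S: "\<And>c. (\<lambda>v. a v + (\<Sum>i<N. c i * b i v)) \<in> S"
    and e: "\<And>k. k < N \<Longrightarrow> e k \<in> V \<and> b k (e k) \<noteq> 0 \<and> (\<forall>i<k. b i (e k) = 0)"
  shows "enat N \<le> zariski_dim V S"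
proof -
  define \<sigma> where "\<sigma> k c = (\<lambda>v. a v + (\<Sum>i<k. c i * b i v))" for k and c :: "nat \<Rightarrow> rat"
  define Z where "Z k = zariski_closure V (range (\<sigma> k))" for k
  have \<sigma>_Suc: "\<sigma> k c = \<sigma> (Suc k) (c(k := 0))" for k c
    unfolding \<sigma>_def by (intro ext) simp
  have \<sigma>_in_S: "range (\<sigma> k) \<subseteq> S" if "k \<le> N" for k
  proof -
    have "\<sigma> k c = (\<lambda>v. a v + (\<Sum>i<N. (if i < k then c i else 0) * b i v))" for c
      unfolding \<sigma>_def using that
      by (intro ext arg_cong2[where f = "(+)"] refl sum.mono_neutral_cong_left) auto
    then show ?thesis using S by auto
  qed
  have irr: "irreducible_closed (zariski (qpoly_ring V)) (Z k)" for k
    unfolding Z_def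
  proof (rule irreducible_closed_line_closed)
    fix x y t assume "x \<in> range (\<sigma> k)" "y \<in> range (\<sigma> k)"
    then obtain c d where "x = \<sigma> k c" "y = \<sigma> k d" by blast
    then have "(\<lambda>v. x v + t * (y v - x v)) = \<sigma> k (\<lambda>i. c i + t * (d i - c i))"
      unfolding \<sigma>_def
      by (intro ext) (simp add: algebra_simps sum.distrib sum_subtractf sum_distrib_left)
    then show "(\<lambda>v. x v + t * (y v - x v)) \<in> range (\<sigma> k)" by blast
  qed simp
  have mono: "zariski_closure V A \<subseteq> zariski_closure V B" if "A \<subseteq> B" for A B
    unfolding zariski_closure_def using that by (intro closure_of_mono image_mono)
  have "Z k \<subset> Z (Suc k)" if k: "k < N" for k
  proof
    show "Z k \<subseteq> Z (Suc k)" unfolding Z_def by (rule mono) (use \<sigma>_Suc in auto)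
    \<comment> \<open>This is the point \<open>a + b k\<close>. It leaves the hyperplane on which
      coordinate \<open>e k\<close> has the value \<open>a (e k)\<close>, and \<open>Z k\<close>
      lies in that hyperplane.\<close>
    let ?c = "\<sigma> (Suc k) (\<lambda>i. if i = k then 1 else 0)"
    have e0: "(\<Sum>i<k. c i * b i (e k)) = 0" for c
      using e[OF k] by (intro sum.neutral) auto
    have "rational_point V ?c \<in> Z (Suc k)"
      unfolding Z_def zariski_closure_def
      by (rule subsetD[OF closure_of_subset])
        (auto simp: topspace_zariski_qpoly_ring rational_point_Spec)
    moreover have "rational_point V ?c \<notin> Z k"
    proof
      assume "rational_point V ?c \<in> Z k"
      moreover have "x (e k) = a (e k)" if "x \<in> range (\<sigma> k)" for x
        using that e0 by (auto simp: \<sigma>_def)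
      ultimately have "?c (e k) = a (e k)"
        using e[OF k] unfolding Z_def
        by (intro zariski_closure_subset_hyperplane[of "e k" V "range (\<sigma> k)" "a (e k)" ?c]) simp_all
      then show False using e[OF k] e0 by (simp add: \<sigma>_def)
    qed
    ultimately show "Z k \<noteq> Z (Suc k)" by blast
  qed
  moreover have "irreducible_closed (subtopology (zariski (qpoly_ring V)) (zariski_closure V S)) (Z k)"
    if "k \<le> N" for k
    using irr mono[OF \<sigma>_in_S[OF that]] unfolding Z_def
    by (intro irreducible_closed_subtopology) (auto simp: zariski_closure_def)
  ultimately show ?thesis
    unfolding zariski_dim_def krull_dim_def by (intro Sup_upper) blast
qed

section \<open>Affine and quadratic functions, and their homogenisations\<close>

text \<open>These are polynomial functions of degree at most one in the first \<open>N\<close>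
  coordinates. The rules let explicit formulas be recognised by matching; forms enter only when a
  map is homogenised.\<close>

inductive affine_fun :: "nat \<Rightarrow> ((nat \<Rightarrow> rat) \<Rightarrow> rat) \<Rightarrow> bool" for N where
  affine_const: "affine_fun N (\<lambda>x. c)"
| affine_cmult: "affine_fun N f \<Longrightarrow> affine_fun N (\<lambda>x. c * f x)"
| affine_coord: "i < N \<Longrightarrow> affine_fun N (\<lambda>x. x i)"
| affine_add: "affine_fun N f \<Longrightarrow> affine_fun N g \<Longrightarrow> affine_fun N (\<lambda>x. f x + g x)"

inductive quadratic_fun :: "nat \<Rightarrow> ((nat \<Rightarrow> rat) \<Rightarrow> rat) \<Rightarrow> bool" for N where
  quadratic_mult: "affine_fun N f \<Longrightarrow> affine_fun N g \<Longrightarrow> quadratic_fun N (\<lambda>x. f x * g x)"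
| quadratic_add: "quadratic_fun N f \<Longrightarrow> quadratic_fun N g \<Longrightarrow> quadratic_fun N (\<lambda>x. f x + g x)"

lemma affine_diff: "affine_fun N f \<Longrightarrow> affine_fun N g \<Longrightarrow> affine_fun N (\<lambda>x. f x - g x)"
  using affine_add[OF _ affine_cmult[where c = "-1"]] by fastforce

lemma affine_quadratic: "affine_fun N f \<Longrightarrow> quadratic_fun N f"
  using quadratic_mult[OF affine_const[where c = 1]] by fastforce

lemma quadratic_cmult: "quadratic_fun N f \<Longrightarrow> quadratic_fun N (\<lambda>x. c * f x)"
proof (induction rule: quadratic_fun.induct)
  case (quadratic_mult f g)
  then show ?case
    using quadratic_fun.quadratic_mult[OF affine_cmult] by (fastforce simp: mult.assoc)
qed (simp add: quadratic_add distrib_left)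

lemma quadratic_diff:
  "quadratic_fun N f \<Longrightarrow> quadratic_fun N g \<Longrightarrow> quadratic_fun N (\<lambda>x. f x - g x)"
  using quadratic_add[OF _ quadratic_cmult[where c = "-1"]] by fastforce

lemma affine_fun_mono: "affine_fun N f \<Longrightarrow> N \<le> M \<Longrightarrow> affine_fun M f"
  by (induction rule: affine_fun.induct) (auto intro: affine_fun.intros)

lemma quadratic_fun_mono: "quadratic_fun N f \<Longrightarrow> N \<le> M \<Longrightarrow> quadratic_fun M f"
  by (induction rule: quadratic_fun.induct) (auto intro: quadratic_fun.intros affine_fun_mono)

lemma affine_fun_cong: "affine_fun N f \<Longrightarrow> (\<And>i. i < N \<Longrightarrow> x i = y i) \<Longrightarrow> f x = f y"
  by (induction rule: affine_fun.induct) auto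

lemma quadratic_fun_cong: "quadratic_fun N f \<Longrightarrow> (\<And>i. i < N \<Longrightarrow> x i = y i) \<Longrightarrow> f x = f y"
proof (induction rule: quadratic_fun.induct)
  case (quadratic_mult f g)
  then show ?case using affine_fun_cong by metis
next
  case (quadratic_add f g)
  then show ?case by metis
qed

section \<open>Homogenisation with respect to the last coordinate\<close>

lemma mdegree_superset:
  "finite A \<Longrightarrow> Poly_Mapping.keys m \<subseteq> A \<Longrightarrow> mdegree m = (\<Sum>v\<in>A. Poly_Mapping.lookup m v)"
  unfolding mdegree_def by (rule sum.mono_neutral_left) (auto simp: in_keys_iff)

lemma mdegree_add: "mdegree (m + m') = mdegree m + mdegree m'"
proof -
  let ?A = "Poly_Mapping.keys m \<union> Poly_Mapping.keys m'"
  have "Poly_Mapping.keys (m + m') \<subseteq> ?A" by (rule Poly_Mapping.keys_add)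
  then show ?thesis
    by (subst (1 2 3) mdegree_superset[of ?A]) (simp_all add: lookup_add sum.distrib)
qed

lemma form_monomials_add:
  "m \<in> form_monomials N d \<Longrightarrow> m' \<in> form_monomials N d' \<Longrightarrow> m + m' \<in> form_monomials N (d + d')"
  using Poly_Mapping.keys_add[of m m'] by (auto simp: form_monomials_def monomials_in_def mdegree_add)

lemma single_form_monomials: "i \<le> N \<Longrightarrow> Poly_Mapping.single i d \<in> form_monomials N d"
  by (auto simp: form_monomials_def monomials_in_def mdegree_def)

lemma keys_mult_form_monomials:
  assumes "Poly_Mapping.keys p \<subseteq> form_monomials N d" "Poly_Mapping.keys q \<subseteq> form_monomials N d'"
  shows "Poly_Mapping.keys (p * q) \<subseteq> form_monomials N (d + d')"
  using Poly_Mapping.keys_mult[of p q] form_monomials_add assms by blast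

text \<open>A constant \<open>c\<close> becomes \<open>c\<close> times the last coordinate, which is
  why agreement holds in the chart \<open>x N = 1\<close>.\<close>

lemma affine_fun_form:
  assumes "affine_fun N f"
  shows "\<exists>p. Poly_Mapping.keys p \<subseteq> form_monomials N 1 \<and> (\<forall>x. x N = 1 \<longrightarrow> qeval x p = f x)"
  using assms
proof (induction rule: affine_fun.induct)
  case (affine_const c)
  show ?case
    using single_form_monomials[of N N 1]
    by (intro exI[of _ "Poly_Mapping.single (Poly_Mapping.single N 1) c"])
      (auto simp: qeval_single meval_def)
next
  case (affine_cmult f c)
  then obtain p where p: "Poly_Mapping.keys p \<subseteq> form_monomials N 1" "\<forall>x. x N = 1 \<longrightarrow> qeval x p = f x"
    by blast
  \<comment> \<open>\<open>Poly_Mapping.single 0 c\<close> is the constant polynomial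
    \<open>c\<close>, a form of degree 0.\<close>
  have "Poly_Mapping.keys (Poly_Mapping.single 0 c * p) \<subseteq> form_monomials N (0 + 1)"
    using p(1) by (intro keys_mult_form_monomials) (auto simp: form_monomials_def monomials_in_def mdegree_def)
  then show ?case
    using p(2) by (intro exI[of _ "Poly_Mapping.single 0 c * p"])
      (auto simp: qeval_mult qeval_single meval_def)
next
  case (affine_coord i)
  then show ?case
    using single_form_monomials[of i N 1]
    by (intro exI[of _ "Poly_Mapping.single (Poly_Mapping.single i 1) 1"])
      (auto simp: qeval_single meval_def)
next
  case (affine_add f g)
  then obtain p q where "Poly_Mapping.keys p \<subseteq> form_monomials N 1" "\<forall>x. x N = 1 \<longrightarrow> qeval x p = f x"
    "Poly_Mapping.keys q \<subseteq> form_monomials N 1" "\<forall>x. x N = 1 \<longrightarrow> qeval x q = g x"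
    by blast
  then show ?case
    using Poly_Mapping.keys_add[of p q] by (intro exI[of _ "p + q"]) (auto simp: qeval_add)
qed

lemma quadratic_fun_form:
  assumes "quadratic_fun N f"
  obtains p where "Poly_Mapping.keys p \<subseteq> form_monomials N 2" "\<And>x. x N = 1 \<Longrightarrow> qeval x p = f x"
proof -
  from assms have "\<exists>p. Poly_Mapping.keys p \<subseteq> form_monomials N 2 \<and> (\<forall>x. x N = 1 \<longrightarrow> qeval x p = f x)"
  proof (induction rule: quadratic_fun.induct)
    case (quadratic_mult f g)
    obtain p where p: "Poly_Mapping.keys p \<subseteq> form_monomials N 1" "\<forall>x. x N = 1 \<longrightarrow> qeval x p = f x"
      using affine_fun_form[OF quadratic_mult(1)] by blast
    obtain q where q: "Poly_Mapping.keys q \<subseteq> form_monomials N 1" "\<forall>x. x N = 1 \<longrightarrow> qeval x q = g x"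
      using affine_fun_form[OF quadratic_mult(2)] by blast
    show ?case
      using keys_mult_form_monomials[OF p(1) q(1)] p(2) q(2)
      by (intro exI[of _ "p * q"]) (simp add: qeval_mult numeral_2_eq_2)
  next
    case (quadratic_add f g)
    then obtain p q where "Poly_Mapping.keys p \<subseteq> form_monomials N 2" "\<forall>x. x N = 1 \<longrightarrow> qeval x p = f x"
      "Poly_Mapping.keys q \<subseteq> form_monomials N 2" "\<forall>x. x N = 1 \<longrightarrow> qeval x q = g x"
      by blast
    then show ?case
      using Poly_Mapping.keys_add[of p q] by (intro exI[of _ "p + q"]) (auto simp: qeval_add)
  qed
  then show ?thesis using that by blast
qed

lemma qeval_homogeneous:
  assumes "Poly_Mapping.keys p \<subseteq> form_monomials N d"
  shows "qeval (\<lambda>i. c * x i) p = c ^ d * qeval x p"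
proof -
  have "meval (\<lambda>i. c * x i) m = c ^ d * meval x m" if "m \<in> Poly_Mapping.keys p" for m
  proof -
    have "mdegree m = d" using that assms by (auto simp: form_monomials_def)
    then show ?thesis
      by (simp add: meval_def mdegree_def power_mult_distrib prod.distrib flip: power_sum)
  qed
  then show ?thesis by (simp add: qeval_def sum_distrib_left algebra_simps)
qed

section \<open>Cycles in the affine chart\<close>

text \<open>Coordinates from \<open>N\<close> on are kept at 0, so that equality of functions is
  equality of points of affine \<open>N\<close>-space.\<close>

definition quadratic_map :: "nat \<Rightarrow> ((nat \<Rightarrow> rat) \<Rightarrow> nat \<Rightarrow> rat) \<Rightarrow> bool" where
  "quadratic_map N F \<longleftrightarrow>
     (\<forall>i<N. quadratic_fun N (\<lambda>x. F x i)) \<and> (\<forall>x. \<forall>i\<ge>N. F x i = 0)"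

text \<open>The clause \<open>\<exists>y. r y \<noteq> 0\<close> excludes the zero quadric, whose
  deformations \<open>F + c r\<close> would all coincide.\<close>

definition quadric_cycle :: "nat \<Rightarrow> nat \<Rightarrow> bool" where
  "quadric_cycle N n \<longleftrightarrow> (\<exists>F r x. quadratic_map N F \<and> quadratic_fun N r \<and> (\<exists>y. r y \<noteq> 0) \<and>
     (\<forall>i\<ge>N. x i = 0) \<and> n \<ge> 1 \<and> (F ^^ n) x = x \<and> (\<forall>k. 0 < k \<and> k < n \<longrightarrow> (F ^^ k) x \<noteq> x) \<and>
     (\<forall>k<n. r ((F ^^ k) x) = 0))"

section \<open>From affine cycles to projective periodic points and families\<close>

lemma proj_point_self: "x \<in> proj_point x"
  unfolding proj_point_def mem_Collect_eq by (intro exI[of _ 1]) simp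

text \<open>All coordinate forms have the same degree \<open>d\<close>, so rescaling a
  representative rescales the image by a common factor. The graph is therefore single-valued at
  \<open>proj_point y\<close>, and the image again has last coordinate 1.\<close>

lemma proj_graph_chart:
  fixes \<phi> :: "nat \<Rightarrow> nat qpoly"
  assumes \<phi>: "polynomial_map N d \<phi>"
    and G: "\<And>x i. x N = 1 \<Longrightarrow> i < N \<Longrightarrow> qeval x (\<phi> i) = G x i"
    and y: "\<forall>i>N. y i = 0" "y N = 1"
  shows "(proj_point y, Q) \<in> proj_graph N \<phi> \<longleftrightarrow>
    Q = proj_point (\<lambda>i. if i < N then G y i else if i = N then 1 else 0)"
proof -
  have homog: "qeval (\<lambda>i. c * x i) (\<phi> i) = c ^ d * qeval x (\<phi> i)" for c x i
  proof -
    consider "i < N" | "i = N" | "i > N" by linarith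
    then show ?thesis
    proof cases
      case 1
      then show ?thesis using \<phi> by (auto simp: polynomial_map_def intro: qeval_homogeneous)
    next
      case 2
      then show ?thesis using \<phi>
        by (simp add: polynomial_map_def qeval_single meval_def power_mult_distrib)
    next
      case 3
      then show ?thesis using \<phi> by (simp add: polynomial_map_def qeval_zero)
    qed
  qed
  let ?G = "\<lambda>i. if i < N then G y i else if i = N then 1 else 0"
  have val: "(\<lambda>i. qeval y (\<phi> i)) = ?G"
  proof
    fix i
    consider "i < N" | "i = N" | "i > N" by linarith
    then show "qeval y (\<phi> i) = ?G i"
      by cases (use G \<phi> y in \<open>auto simp: polynomial_map_def qeval_single qeval_zero meval_def\<close>)
  qed
  have scale: "proj_point (\<lambda>i. c * x i) = proj_point x" if "c \<noteq> 0" for c x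
  proof -
    have "\<exists>b. (\<lambda>i. a * x i) = (\<lambda>i. b * (c * x i)) \<and> b \<noteq> 0" if "a \<noteq> 0" for a
      using that \<open>c \<noteq> 0\<close> by (intro exI[of _ "a / c"]) auto
    moreover have "\<exists>b. (\<lambda>i. a * (c * x i)) = (\<lambda>i. b * x i) \<and> b \<noteq> 0" if "a \<noteq> 0" for a
      using that \<open>c \<noteq> 0\<close> by (intro exI[of _ "a * c"]) auto
    ultimately show ?thesis unfolding proj_point_def by auto
  qed
  show ?thesis
  proof
    assume "(proj_point y, Q) \<in> proj_graph N \<phi>"
    then obtain x where x: "proj_point y = proj_point x" "Q = proj_point (\<lambda>i. qeval x (\<phi> i))"
      by (auto simp: proj_graph_def)
    then obtain c where c: "x = (\<lambda>i. c * y i)" "c \<noteq> 0"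
      using proj_point_self[of x] unfolding x(1)[symmetric] by (auto simp: proj_point_def)
    have "Q = proj_point (\<lambda>i. c ^ d * qeval y (\<phi> i))"
      unfolding x(2) c(1) homog ..
    also have "\<dots> = proj_point (\<lambda>i. qeval y (\<phi> i))"
      using scale c(2) by simp
    finally show "Q = proj_point ?G" unfolding val .
  next
    assume "Q = proj_point ?G"
    moreover have "y \<in> homogeneous_coords N"
      using y by (auto simp: homogeneous_coords_def dest: fun_cong[of _ _ N])
    moreover have "?G \<in> homogeneous_coords N"
      by (auto simp: homogeneous_coords_def dest: fun_cong[of _ _ N])
    ultimately show "(proj_point y, Q) \<in> proj_graph N \<phi>"
      unfolding proj_graph_def mem_Collect_eq by (intro exI[of _ y]) (simp add: val)
  qed
qed

lemma proj_point_chart_inj: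
  assumes "proj_point (x(N := 1)) = proj_point (y(N := 1))" "x N = y N"
  shows "x = y"
proof -
  obtain c where c: "x(N := 1) = (\<lambda>i. c * (y(N := 1)) i)"
    using proj_point_self[of "x(N := 1)"] unfolding assms(1) by (auto simp: proj_point_def)
  have "c = 1" using fun_cong[OF c, of N] by simp
  then have "(x(N := 1)) i = (y(N := 1)) i" for i using c by simp
  then show ?thesis using assms(2) by (intro ext) (metis fun_upd_other)
qed

text \<open>The map \<open>G\<close> induced by \<open>\<phi>\<close> has to agree with
  \<open>F\<close> only along the orbit of \<open>x\<close>. Thus one cycle of \<open>F\<close>
  serves every deformation that vanishes on it.\<close>

lemma primitive_period_chart:
  fixes \<phi> :: "nat \<Rightarrow> nat qpoly"
  assumes \<phi>: "polynomial_map N d \<phi>"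
    and G: "\<And>x i. x N = 1 \<Longrightarrow> i < N \<Longrightarrow> qeval x (\<phi> i) = G x i"
    and FG: "\<And>k i. i < N \<Longrightarrow> G (((F ^^ k) x)(N := 1)) i = (F ^^ Suc k) x i"
    and supp: "\<And>k i. i \<ge> N \<Longrightarrow> (F ^^ k) x i = 0"
    and per: "n \<ge> 1" "(F ^^ n) x = x" "\<And>k. 0 < k \<Longrightarrow> k < n \<Longrightarrow> (F ^^ k) x \<noteq> x"
  shows "primitive_period N \<phi> (proj_point (x(N := 1))) n"
proof -
  let ?p = "\<lambda>k. proj_point (((F ^^ k) x)(N := 1))"
  have step: "(?p k, Q) \<in> proj_graph N \<phi> \<longleftrightarrow> Q = ?p (Suc k)" for k Q
  proof -
    have "(\<lambda>i. if i < N then G (((F ^^ k) x)(N := 1)) i else if i = N then 1 else 0)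
        = ((F ^^ Suc k) x)(N := 1)"
      using FG supp[of _ "Suc k"] by (intro ext) auto
    then show ?thesis using proj_graph_chart[OF \<phi> G, of "((F ^^ k) x)(N := 1)" Q] supp by simp
  qed
  have "(?p 0, Q) \<in> proj_graph N \<phi> ^^ k \<longleftrightarrow> Q = ?p k" for k Q
    by (induction k arbitrary: Q) (use step in \<open>auto simp: relcomp.simps simp del: funpow.simps\<close>)
  moreover have "?p k = ?p 0 \<longleftrightarrow> (F ^^ k) x = x" for k
    using proj_point_chart_inj[of "(F ^^ k) x" N x] supp[of N k] supp[of N 0] by auto
  ultimately have "has_period N \<phi> (proj_point (x(N := 1))) k \<longleftrightarrow> k \<ge> 1 \<and> (F ^^ k) x = x" for k
    unfolding has_period_def by (metis funpow_0)
  then show ?thesis using per unfolding primitive_period_def by fastforce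
qed

lemma quadric_cycle_family:
  assumes "N \<ge> 1" and "quadric_cycle N n"
  shows "\<exists>F. F \<subseteq> {\<phi>. polynomial_map N 2 \<phi>} \<and> infinite F \<and>
    (\<forall>\<phi>\<in>F. \<exists>P\<in>proj_space N. primitive_period N \<phi> P n) \<and> enat N \<le> family_dim N 2 F"
proof -
  obtain F r x where F: "quadratic_map N F" and r: "quadratic_fun N r" "\<exists>y. r y \<noteq> 0"
    and x: "\<forall>i\<ge>N. x i = 0" and n: "n \<ge> 1" "(F ^^ n) x = x" "\<forall>k. 0 < k \<and> k < n \<longrightarrow> (F ^^ k) x \<noteq> x"
    and rx: "\<forall>k<n. r ((F ^^ k) x) = 0"
    using assms(2) unfolding quadric_cycle_def by blast
  have "\<exists>p. Poly_Mapping.keys p \<subseteq> form_monomials N 2 \<and> (\<forall>x. x N = 1 \<longrightarrow> qeval x p = F x i)" if "i < N" for i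
    using quadratic_fun_form[of N "\<lambda>x. F x i"] F that unfolding quadratic_map_def by metis
  then obtain p where p: "\<And>i. i < N \<Longrightarrow> Poly_Mapping.keys (p i) \<subseteq> form_monomials N 2"
    "\<And>i x. i < N \<Longrightarrow> x N = 1 \<Longrightarrow> qeval x (p i) = F x i"
    by metis
  obtain R where R: "Poly_Mapping.keys R \<subseteq> form_monomials N 2" "\<And>x. x N = 1 \<Longrightarrow> qeval x R = r x"
    using quadratic_fun_form[OF r(1)] by blast
  have "R \<noteq> 0"
  proof
    assume "R = 0"
    obtain y where y: "r y \<noteq> 0" using r(2) by blast
    \<comment> \<open>\<open>r\<close> does not depend on coordinate \<open>N\<close>, so its
      nonzero value is also taken in the chart, where \<open>R\<close> computes
      \<open>r\<close>.\<close>
    have "r (y(N := 1)) = r y" by (rule quadratic_fun_cong[OF r(1)]) simp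
    then show False using R(2)[of "y(N := 1)"] y \<open>R = 0\<close> by (simp add: qeval_zero)
  qed
  then obtain m where m: "m \<in> Poly_Mapping.keys R" by fastforce
  define sc where "sc c = Poly_Mapping.map ((*) c) R" for c
  have lookup_sc: "Poly_Mapping.lookup (sc c) k = c * Poly_Mapping.lookup R k" for c k
    by (simp add: sc_def Poly_Mapping.map.rep_eq when_def)
  have keys_sc: "Poly_Mapping.keys (sc c) \<subseteq> Poly_Mapping.keys R" for c
    by (auto simp: in_keys_iff lookup_sc)
  have qeval_sc: "qeval x (sc c) = c * qeval x R" for x c
    using keys_sc[of c] by (simp add: qeval_sup[of "Poly_Mapping.keys R"] lookup_sc sum_distrib_left mult.assoc)
  define \<phi> where "\<phi> c i = (if i < N then p i + sc (c i)
     else if i = N then Poly_Mapping.single (Poly_Mapping.single N 2) 1 else 0)"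
    for c :: "nat \<Rightarrow> rat" and i
  have pm: "polynomial_map N 2 (\<phi> c)" for c
  proof -
    have "Poly_Mapping.keys (p i + sc (c i)) \<subseteq> form_monomials N 2" if "i < N" for i
      using Poly_Mapping.keys_add[of "p i" "sc (c i)"] p(1)[OF that] R(1) keys_sc[of "c i"] by blast
    then show ?thesis by (simp add: polynomial_map_def \<phi>_def)
  qed
  have "primitive_period N (\<phi> c) (proj_point (x(N := 1))) n" for c
  proof (rule primitive_period_chart[OF pm, where G = "\<lambda>y i. F y i + c i * r y" and F = F])
    fix y :: "nat \<Rightarrow> rat" and i assume "y N = 1" "i < N"
    then show "qeval y (\<phi> c i) = F y i + c i * r y"
      by (simp add: \<phi>_def qeval_add p R qeval_sc)
  next
    fix k i assume i: "i < N"
    let ?y = "(F ^^ k) x"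
    have "F (?y(N := 1)) i = F ?y i"
      using F i by (intro quadratic_fun_cong[of N "\<lambda>x. F x i"]) (auto simp: quadratic_map_def)
    moreover have "r (?y(N := 1)) = r ?y" by (rule quadratic_fun_cong[OF r(1)]) simp
    \<comment> \<open>The vanishing of \<open>r\<close> is given for one period; periodicity extends
      it to the whole orbit.\<close>
    moreover have "?y = (F ^^ (k mod n)) x" using funpow_mod_eq[OF n(2)] by simp
    then have "r ?y = 0" using rx n(1) by simp
    ultimately show "F (?y(N := 1)) i + c i * r (?y(N := 1)) = (F ^^ Suc k) x i" by simp
  next
    fix k i assume "N \<le> i"
    then show "(F ^^ k) x i = 0" using x F by (cases k) (auto simp: quadratic_map_def)
  qed (use n in auto)
  moreover have "proj_point (x(N := 1)) \<in> proj_space N"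
    unfolding proj_space_def homogeneous_coords_def
    using x by (intro imageI) (auto simp: fun_eq_iff intro: exI[of _ N])
  moreover have "infinite (range \<phi>)"
  proof -
    \<comment> \<open>Giving all coordinates the same parameter \<open>t\<close> already yields
      infinitely many maps: the coefficient at \<open>m\<close>, which is nonzero in
      \<open>R\<close>, recovers \<open>t\<close>.\<close>
    have "inj (\<lambda>t. \<phi> (\<lambda>_. t))"
    proof (rule injI)
      fix s t assume "\<phi> (\<lambda>_. s) = \<phi> (\<lambda>_. t)"
      then have "Poly_Mapping.lookup (\<phi> (\<lambda>_. s) 0) m = Poly_Mapping.lookup (\<phi> (\<lambda>_. t) 0) m" by simp
      then show "s = t" using assms(1) m by (simp add: \<phi>_def lookup_add lookup_sc in_keys_iff)
    qed
    then have "infinite (range (\<lambda>t. \<phi> (\<lambda>_. t)))"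
      using finite_imageD infinite_UNIV_char_0[where 'a = rat] by blast
    then show ?thesis by (rule infinite_super[rotated]) auto
  qed
  moreover have "enat N \<le> family_dim N 2 (range \<phi>)"
    unfolding family_dim_def
  proof (rule zariski_dim_ge)
    fix c :: "nat \<Rightarrow> rat"
    \<comment> \<open>The coefficient vectors form an affine space: direction \<open>i\<close> puts
      the coefficients of \<open>R\<close> into the block of the \<open>i\<close>-th form.\<close>
    have "(\<lambda>v. coeff_vector (\<phi> (\<lambda>_. 0)) v + (\<Sum>i<N. c i * (if fst v = i then Poly_Mapping.lookup R (snd v) else 0)))
      = coeff_vector (\<phi> c)"
      by (intro ext) (auto simp: coeff_vector_def \<phi>_def lookup_add lookup_sc if_distrib[of "(*) _"] sum.delta' cong: if_cong)
    then show "(\<lambda>v. coeff_vector (\<phi> (\<lambda>_. 0)) v + (\<Sum>i<N. c i * (if fst v = i then Poly_Mapping.lookup R (snd v) else 0)))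
      \<in> coeff_vector ` range \<phi>" by auto
  next
    \<comment> \<open>The coordinate \<open>(k, m)\<close> sees only direction \<open>k\<close>,
      which gives triangularity.\<close>
    fix k assume "k < N"
    then show "(k, m) \<in> coeff_index N 2 \<and>
        (if fst (k, m) = k then Poly_Mapping.lookup R (snd (k, m)) else 0) \<noteq> 0 \<and>
        (\<forall>i<k. (if fst (k, m) = i then Poly_Mapping.lookup R (snd (k, m)) else 0) = 0)"
      using m R(1) by (auto simp: coeff_index_def in_keys_iff)
  qed
  ultimately show ?thesis using pm by (intro exI[of _ "range \<phi>"]) auto
qed

section \<open>Closing and doubling paths\<close>

text \<open>Here \<open>m\<close> counts steps, so the path has \<open>m + 1\<close> points. Since
  \<open>q\<close> is 1 at the end, adding \<open>v * q\<close> to the map shifts the image of the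
  last point by exactly \<open>v\<close>.\<close>

definition indicated_path ::
    "nat \<Rightarrow> nat \<Rightarrow> ((nat \<Rightarrow> rat) \<Rightarrow> nat \<Rightarrow> rat) \<Rightarrow> ((nat \<Rightarrow> rat) \<Rightarrow> rat) \<Rightarrow> (nat \<Rightarrow> rat) \<Rightarrow> bool" where
  "indicated_path N m F q x \<longleftrightarrow> quadratic_map N F \<and> quadratic_fun N q \<and> (\<forall>i\<ge>N. x i = 0) \<and>
     (\<forall>k<m. q ((F ^^ k) x) = 0) \<and> q ((F ^^ m) x) = 1"

definition quadric_path :: "nat \<Rightarrow> nat \<Rightarrow> bool" where
  "quadric_path N m \<longleftrightarrow> (\<exists>F q r x. indicated_path N m F q x \<and>
     quadratic_fun N r \<and> (\<exists>y. r y \<noteq> 0) \<and> (\<forall>k\<le>m. r ((F ^^ k) x) = 0))"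

lemma indicated_path_supp: "indicated_path N m F q x \<Longrightarrow> N \<le> i \<Longrightarrow> (F ^^ k) x i = 0"
  by (cases k) (auto simp: indicated_path_def quadratic_map_def)

text \<open>The last \<open>n\<close> points are closed up by redirecting the end of the path with
  \<open>q\<close>. An earlier return would make the end coincide with an earlier point, where
  \<open>q\<close> vanishes.\<close>

lemma quadric_cycle_of_path:
  assumes "quadric_path N m" "1 \<le> n" "n \<le> m + 1"
  shows "quadric_cycle N n"
proof -
  obtain F q r x where path: "indicated_path N m F q x"
    and r: "quadratic_fun N r" "\<exists>y. r y \<noteq> 0" "\<forall>k\<le>m. r ((F ^^ k) x) = 0"
    using assms(1) unfolding quadric_path_def by blast
  note supp = indicated_path_supp[OF path]
  \<comment> \<open>The tail from index \<open>s\<close> to index \<open>m\<close> has exactly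
    \<open>n\<close> points.\<close>
  define s where "s = m + 1 - n"
  define y where "y = (F ^^ s) x"
  define G where "G z = (\<lambda>i. F z i + (y i - (F ^^ Suc m) x i) * q z)" for z
  have F: "quadratic_map N F" and q: "quadratic_fun N q"
    and q0: "\<forall>k<m. q ((F ^^ k) x) = 0" and q1: "q ((F ^^ m) x) = 1"
    using path unfolding indicated_path_def by blast+
  have G: "quadratic_map N G"
    unfolding quadratic_map_def
  proof (intro conjI allI impI)
    fix i assume "i < N"
    then show "quadratic_fun N (\<lambda>x. G x i)"
      unfolding G_def using F q
      by (intro quadratic_add quadratic_cmult) (auto simp: quadratic_map_def)
  next
    fix z i assume "N \<le> i"
    then show "G z i = 0"
      using F supp[of i s] supp[of i "Suc m"] by (simp add: G_def y_def quadratic_map_def)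
  qed
  have iter: "(G ^^ k) y = (F ^^ (s + k)) x" if "k < n" for k
    using that
  proof (induction k)
    case (Suc k)
    then have "s + k < m" using assms(3) by (simp add: s_def)
    then show ?case using Suc q0 by (simp add: G_def)
  qed (simp add: y_def)
  have "(G ^^ n) y = G ((G ^^ (n - 1)) y)"
    using assms(2) by (cases n) auto
  also have "(G ^^ (n - 1)) y = (F ^^ m) x"
    using assms(2,3) iter[of "n - 1"] by (simp add: s_def)
  also have "G \<dots> = y"
    using q1 by (simp add: G_def)
  finally have per: "(G ^^ n) y = y" .
  have "(G ^^ k) y \<noteq> y" if k: "0 < k" "k < n" for k
  proof
    assume "(G ^^ k) y = y"
    then have eq: "(F ^^ (s + k)) x = (F ^^ s) x" using iter[OF k(2)] by (simp add: y_def)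
    have comp: "(F ^^ a) ((F ^^ b) x) = (F ^^ (a + b)) x" for a b
      by (simp add: funpow_add)
    \<comment> \<open>A return after \<open>k\<close> steps identifies point \<open>m\<close> with
      point \<open>m - k\<close>.\<close>
    have "(F ^^ m) x = (F ^^ (n - 1 - k)) ((F ^^ (s + k)) x)"
      unfolding comp using k assms(3) by (simp add: s_def)
    also have "\<dots> = (F ^^ (m - k)) x"
      unfolding eq comp using k assms(3) by (simp add: s_def)
    finally show False using q0 q1 k assms(3) by simp
  qed
  moreover have "r ((G ^^ k) y) = 0" if "k < n" for k
    using r(3) iter[OF that] that assms(3) by (simp add: s_def)
  ultimately show ?thesis
    unfolding quadric_cycle_def using G r assms(2) per supp
    by (intro exI[of _ G] exI[of _ r] exI[of _ y]) (auto simp: y_def)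
qed

text \<open>
  A coordinate \<open>w\<close> remembers for one step that the end of the path was reached, and \<open>z\<close> toggles
  when \<open>w = 1\<close>; so the path is run through twice, on the hyperplanes \<open>z = 1\<close> and \<open>z = 0\<close>.
\<close>

lemma quadric_path_double:
  assumes path: "indicated_path N m F q x" and m: "1 \<le> m"
  shows "quadric_path (N + 2) (2 * m + 3)"
proof -
  note supp = indicated_path_supp[OF path]
  have F: "quadratic_map N F" and q: "quadratic_fun N q"
    and q0: "\<forall>k<m. q ((F ^^ k) x) = 0" and q1: "q ((F ^^ m) x) = 1"
    using path unfolding indicated_path_def by blast+
  define emb where "emb p w z = (\<lambda>i. if i < N then p i else if i = N then w else if i = N + 1 then z else 0)"
    for p :: "nat \<Rightarrow> rat" and w z :: rat
  \<comment> \<open>At the end of a run \<open>q = 1\<close> and \<open>w = 0\<close>, so the second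
    term sends the point back to \<open>x\<close>. At \<open>x\<close> with \<open>w = 1\<close> the
    third term holds the point still for one step while \<open>w\<close> returns to 0. The last
    coordinate is the exclusive or of \<open>w\<close> and \<open>z\<close>.\<close>
  define G where "G X = (\<lambda>i. if i < N then F X i + (x i - (F ^^ Suc m) x i) * q X + (x i - F x i) * X N
      else if i = N then q X else if i = N + 1 then X N + X (N + 1) - 2 * (X N * X (N + 1)) else 0)"
    for X :: "nat \<Rightarrow> rat"
  have emb_simps: "emb p w z N = w" "emb p w z (N + 1) = z" for p w z
    by (simp_all add: emb_def)
  have F_emb: "F (emb p w z) i = F p i" if "i < N" for p w z i
    using F that by (intro quadratic_fun_cong[of N "\<lambda>x. F x i"]) (auto simp: quadratic_map_def emb_def)
  have q_emb: "q (emb p w z) = q p" for p w z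
    by (rule quadratic_fun_cong[OF q]) (simp add: emb_def)
  have G_emb: "G (emb p w z) = emb (\<lambda>i. F p i + (x i - (F ^^ Suc m) x i) * q p + (x i - F x i) * w)
      (q p) (w + z - 2 * (w * z))" for p w z
    unfolding G_def q_emb by (intro ext) (use F_emb in \<open>auto simp: emb_def\<close>)
  have G: "quadratic_map (N + 2) G"
    unfolding quadratic_map_def
  proof (intro conjI allI impI)
    fix i assume "i < N + 2"
    have "quadratic_fun (N + 2) (\<lambda>X. F X i + (x i - (F ^^ Suc m) x i) * q X + (x i - F x i) * X N)" if "i < N"
      using F q that
      by (intro quadratic_add quadratic_cmult affine_quadratic[OF affine_coord])
        (auto simp: quadratic_map_def intro: quadratic_fun_mono)
    moreover have "quadratic_fun (N + 2) (\<lambda>X. X N + X (N + 1) - 2 * (X N * X (N + 1)))"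
      by (intro quadratic_add quadratic_diff quadratic_cmult quadratic_mult affine_coord
          affine_quadratic[OF affine_coord]) auto
    moreover have "quadratic_fun (N + 2) q" using q by (rule quadratic_fun_mono) simp
    ultimately show "quadratic_fun (N + 2) (\<lambda>X. G X i)"
      using \<open>i < N + 2\<close> by (cases "i < N"; cases "i = N") (simp_all add: G_def less_Suc_eq)
  qed (simp add: G_def)
  have run: "(G ^^ k) (emb x 0 z) = emb ((F ^^ k) x) 0 z" if "k \<le> m" for k z
    using that
  proof (induction k)
    case (Suc k)
    then show ?case using q0 by (simp add: G_emb)
  qed simp
  have turn: "(G ^^ (m + 1)) (emb x 0 z) = emb x 1 z" for z
    using q1 run[of m z] by (simp add: G_emb)
  \<comment> \<open>Since \<open>1 \<le> m\<close>, the start \<open>x\<close> is not the end of the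
    path, so \<open>q x = 0\<close> clears the carry.\<close>
  have reset: "G (emb x 1 z) = emb x 0 (1 - z)" for z
    using q0[rule_format, of 0] m by (simp add: G_emb)
  have half: "(G ^^ (m + 2 + k)) (emb x 0 1) = (G ^^ k) (emb x 0 0)" for k
  proof -
    have "(G ^^ (m + 2)) (emb x 0 1) = emb x 0 0"
      using turn[of 1] reset[of 1] by simp
    then show ?thesis by (simp only: add.commute[of "m + 2"] funpow_add comp_apply)
  qed
  \<comment> \<open>The carry is 1 once with \<open>z = 1\<close> and once with
    \<open>z = 0\<close>; the factor \<open>1 - z\<close> singles out the second time. Along the
    path \<open>z\<close> is 0 or 1, which gives the quadric \<open>?r\<close>.\<close>
  let ?q = "\<lambda>X :: nat \<Rightarrow> rat. X N * (1 - X (N + 1))"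
    and ?r = "\<lambda>X :: nat \<Rightarrow> rat. X (N + 1) * (X (N + 1) - 1)"
  have cases: "?q ((G ^^ k) (emb x 0 1)) = 0 \<and> ?r ((G ^^ k) (emb x 0 1)) = 0" if "k < 2 * m + 3" for k
  proof -
    consider "k \<le> m" | "k = m + 1" | j where "k = m + 2 + j" "j \<le> m"
    proof (cases "k \<le> m + 1")
      case False
      then show ?thesis using that \<open>k < 2 * m + 3\<close> by (intro that(3)[of "k - (m + 2)"]) auto
    qed (use that in linarith)
    then show ?thesis
    proof cases
      case 1
      then show ?thesis unfolding run[OF 1] emb_simps by simp
    next
      case 2
      then show ?thesis unfolding 2 turn emb_simps by simp
    next
      case 3
      then show ?thesis unfolding 3(1) half run[OF 3(2)] emb_simps by simp
    qed
  qed
  have "2 * m + 3 = m + 2 + (m + 1)" by simp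
  then have last: "(G ^^ (2 * m + 3)) (emb x 0 1) = emb x 1 0"
    by (simp only: half turn)
  have "indicated_path (N + 2) (2 * m + 3) G ?q (emb x 0 1)"
    unfolding indicated_path_def
  proof (intro conjI)
    show "quadratic_fun (N + 2) ?q"
      by (intro quadratic_mult affine_diff affine_const affine_coord) auto
    show "?q ((G ^^ (2 * m + 3)) (emb x 0 1)) = 1"
      unfolding last emb_simps by simp
  qed (use G cases in \<open>auto simp: emb_def\<close>)
  moreover have "quadratic_fun (N + 2) ?r"
    by (intro quadratic_mult affine_diff affine_const affine_coord) auto
  moreover have "\<exists>y. ?r y \<noteq> 0" by (rule exI[of _ "\<lambda>_. 2"]) simp
  moreover have "?r ((G ^^ k) (emb x 0 1)) = 0" if "k \<le> 2 * m + 3" for k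
  proof (cases "k = 2 * m + 3")
    case True
    then show ?thesis unfolding True last emb_simps by simp
  qed (use cases that in auto)
  ultimately show ?thesis unfolding quadric_path_def by blast
qed

section \<open>Explicit paths in dimensions two and three\<close>

definition vec :: "rat list \<Rightarrow> nat \<Rightarrow> rat" where
  "vec xs = (\<lambda>i. if i < length xs then xs ! i else 0)"

lemma vec_simps [simp]:
  "vec (a # xs) 0 = a" "vec (a # b # xs) 1 = b" "vec (a # b # c # xs) 2 = c" "vec (a # b # xs) (Suc 0) = b"
  "vec (a # b # c # xs) (Suc (Suc 0)) = c"
  by (simp_all add: vec_def)

lemma vec_zero: "length xs \<le> i \<Longrightarrow> vec xs i = 0"
  by (simp add: vec_def)

lemma vec_eq_iff: "length xs = length ys \<Longrightarrow> vec xs = vec ys \<longleftrightarrow> xs = ys"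
  unfolding vec_def fun_eq_iff by (auto intro!: nth_equalityI split: if_splits)

lemma quadratic_map_vec:
  assumes "list_all (quadratic_fun N) fs" "length fs = N"
  shows "quadratic_map N (\<lambda>x. vec (map (\<lambda>f. f x) fs))"
  using assms by (auto simp: quadratic_map_def vec_def list_all_length)

lemmas quadratic_intros =
  quadratic_add quadratic_diff quadratic_cmult quadratic_mult affine_quadratic
lemmas affine_intros =
  affine_const affine_add affine_diff affine_cmult affine_coord

lemma quadric_path_2: "quadric_path 2 5"
proof -
  \<comment> \<open>On \<open>y = 0\<close> the map is \<open>(1 - 2 x, x (x - 1) / 2)\<close>; the
    coefficients 7 and -3 of \<open>y\<close> are then forced by sending \<open>(3, 1)\<close> to
    \<open>(2, 0)\<close>.\<close>
  define F :: "(nat \<Rightarrow> rat) \<Rightarrow> nat \<Rightarrow> rat" where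
    "F x = vec [1 - 2 * x 0 + 7 * x 1, 1/2 * (x 0 * (x 0 - 1)) - 3 * x 1]" for x
  let ?q = "\<lambda>x :: nat \<Rightarrow> rat. - 1/6 * (x 1 * (x 0 - 3))" and ?r = "\<lambda>x :: nat \<Rightarrow> rat. x 1 * (x 1 - 1)"
  have "list_all (quadratic_fun 2) [\<lambda>x. 1 - 2 * x 0 + 7 * x 1, \<lambda>x. 1/2 * (x 0 * (x 0 - 1)) - 3 * x 1]"
    unfolding list.pred_inject by (intro conjI TrueI; (rule quadratic_intros affine_intros | simp)+)
  from quadratic_map_vec[OF this] have F: "quadratic_map 2 F"
    unfolding F_def by simp
  have qr: "quadratic_fun 2 ?q" "quadratic_fun 2 ?r"
    by (rule quadratic_intros affine_intros | simp)+
  have "F (vec [0, 0]) = vec [1, 0]" "F (vec [1, 0]) = vec [-1, 0]" "F (vec [-1, 0]) = vec [3, 1]"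
    "F (vec [3, 1]) = vec [2, 0]" "F (vec [2, 0]) = vec [-3, 1]"
    by (simp_all add: F_def)
  then have it: "\<forall>k<5. ?q ((F ^^ k) (vec [0, 0])) = 0" "?q ((F ^^ 5) (vec [0, 0])) = 1"
    "\<forall>k\<le>5. ?r ((F ^^ k) (vec [0, 0])) = 0"
    by (simp_all add: eval_nat_numeral All_less_Suc le_Suc_eq all_conj_distrib imp_conjL)
  have nz: "\<exists>y. ?r y \<noteq> 0" by (rule exI[of _ "\<lambda>_. 2"]) simp
  have supp: "\<forall>i\<ge>2. vec [0, 0] i = 0" by (simp add: vec_zero)
  show ?thesis
    unfolding quadric_path_def indicated_path_def
    by (rule exI[of _ F], rule exI[of _ ?q], rule exI[of _ ?r], rule exI[of _ "vec [0, 0]"],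
        (intro conjI F qr supp it nz; simp)+)
qed

text \<open>These seven points lie on no conic: four are on \<open>y = 0\<close>, and the other
  three are not collinear. Hence the path starts the doubling, while period 7 in the plane needs
  \<open>quadric_cycle_2\<close>.\<close>

lemma indicated_path_2: "\<exists>F q x. indicated_path 2 6 F q x"
proof -
  \<comment> \<open>The map on \<open>y = 0\<close> is as in \<open>quadric_path_2\<close>; the
    terms in \<open>y\<close> interpolate the prescribed images of \<open>(3, 1)\<close> and
    \<open>(0, 2)\<close>.\<close>
  define F :: "(nat \<Rightarrow> rat) \<Rightarrow> nat \<Rightarrow> rat" where
    "F x = vec [1 - 2 * x 0 + x 1 * (19/2 - 9/2 * x 1), 1/2 * (x 0 * (x 0 - 1)) + x 1 * (x 1 - 2)]" for x
  \<comment> \<open>The second factor is the line through \<open>(3, 1)\<close> and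
    \<open>(0, 2)\<close>; \<open>-1/6\<close> normalises the value at
    \<open>(-3, 1)\<close>.\<close>
  let ?q = "\<lambda>x :: nat \<Rightarrow> rat. - 1/6 * (x 1 * (x 0 + 3 * x 1 - 6))"
  have "list_all (quadratic_fun 2) [\<lambda>x. 1 - 2 * x 0 + x 1 * (19/2 - 9/2 * x 1),
      \<lambda>x. 1/2 * (x 0 * (x 0 - 1)) + x 1 * (x 1 - 2)]"
    unfolding list.pred_inject by (intro conjI TrueI; (rule quadratic_intros affine_intros | simp)+)
  from quadratic_map_vec[OF this] have F: "quadratic_map 2 F"
    unfolding F_def by simp
  have qr: "quadratic_fun 2 ?q"
    by (rule quadratic_intros affine_intros | simp)+
  have "F (vec [0, 0]) = vec [1, 0]" "F (vec [1, 0]) = vec [-1, 0]" "F (vec [-1, 0]) = vec [3, 1]"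
    "F (vec [3, 1]) = vec [0, 2]" "F (vec [0, 2]) = vec [2, 0]" "F (vec [2, 0]) = vec [-3, 1]"
    by (simp_all add: F_def)
  then have it: "\<forall>k<6. ?q ((F ^^ k) (vec [0, 0])) = 0" "?q ((F ^^ 6) (vec [0, 0])) = 1"
    by (simp_all add: eval_nat_numeral All_less_Suc)
  have supp: "\<forall>i\<ge>2. vec [0, 0] i = 0" by (simp add: vec_zero)
  show ?thesis
    unfolding indicated_path_def
    by (rule exI[of _ F], rule exI[of _ ?q], rule exI[of _ "vec [0, 0]"],
        (intro conjI F qr supp it; simp)+)
qed

text \<open>A cycle with four points on \<open>y = 0\<close> and three on \<open>y = 1\<close>; it was found by a computer search.\<close>

lemma quadric_cycle_2: "quadric_cycle 2 7"
proof -
  define F :: "(nat \<Rightarrow> rat) \<Rightarrow> nat \<Rightarrow> rat" where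
    "F x = vec [4 + 1/2 * x 0 + x 1 * (8 - 5/2 * x 0), 1/12 * (x 0 * (x 0 - 4)) + x 1 * (7/2 - 3/4 * x 0)]" for x
  let ?r = "\<lambda>x :: nat \<Rightarrow> rat. x 1 * (x 1 - 1)"
  have "list_all (quadratic_fun 2) [\<lambda>x. 4 + 1/2 * x 0 + x 1 * (8 - 5/2 * x 0),
      \<lambda>x. 1/12 * (x 0 * (x 0 - 4)) + x 1 * (7/2 - 3/4 * x 0)]"
    unfolding list.pred_inject by (intro conjI TrueI; (rule quadratic_intros affine_intros | simp)+)
  from quadratic_map_vec[OF this] have F: "quadratic_map 2 F"
    unfolding F_def by simp
  have qr: "quadratic_fun 2 ?r"
    by (rule quadratic_intros affine_intros | simp)+
  have "F (vec [0, 0]) = vec [4, 0]" "F (vec [4, 0]) = vec [6, 0]" "F (vec [6, 0]) = vec [7, 1]"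
    "F (vec [7, 1]) = vec [-2, 0]" "F (vec [-2, 0]) = vec [3, 1]" "F (vec [3, 1]) = vec [6, 1]"
    "F (vec [6, 1]) = vec [0, 0]"
    by (simp_all add: F_def)
  then have it: "\<forall>k<7. ?r ((F ^^ k) (vec [0, 0])) = 0" "(F ^^ 7) (vec [0, 0]) = vec [0, 0]"
    "\<forall>k. 0 < k \<and> k < 7 \<longrightarrow> (F ^^ k) (vec [0, 0]) \<noteq> vec [0, 0]"
    by (simp_all add: eval_nat_numeral All_less_Suc less_Suc_eq vec_eq_iff all_conj_distrib imp_conjL)
  have nz: "\<exists>y. ?r y \<noteq> 0" by (rule exI[of _ "\<lambda>_. 2"]) simp
  have supp: "\<forall>i\<ge>2. vec [0, 0] i = 0" by (simp add: vec_zero)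
  show ?thesis
    unfolding quadric_cycle_def
    by (rule exI[of _ F], rule exI[of _ ?r], rule exI[of _ "vec [0, 0]"],
        (intro conjI F qr supp it nz; simp)+)
qed

text \<open>
  The seven points of \<open>indicated_path_2\<close> in the plane \<open>z = 0\<close>, continued by
  \<open>(-1, 0)\<close>, \<open>(0, 0)\<close>, \<open>(1, 0)\<close>, \<open>(2, 1)\<close> in the plane \<open>z = 1\<close>. The first three of these are
  equally spaced on a line on which the quadratic terms are compatible with the prescribed images.
\<close>

lemma quadric_path_3: "quadric_path 3 10"
proof -
  \<comment> \<open>The product \<open>y (x + 3 y - 6)\<close> is -6 times the indicator in
    \<open>indicated_path_2\<close>; its multiples redirect \<open>(-3, 1, 0)\<close> to
    \<open>(-1, 0, 1)\<close>. The terms in \<open>x z\<close> affect only points off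
    \<open>z = 0\<close>.\<close>
  define F :: "(nat \<Rightarrow> rat) \<Rightarrow> nat \<Rightarrow> rat" where
    "F x = vec
      [1 - 2 * x 0 + x 1 * (19/2 - 9/2 * x 1) + 13/6 * (x 1 * (x 0 + 3 * x 1 - 6)) + 3 * (x 0 * x 2),
       1/2 * (x 0 * (x 0 - 1)) + x 1 * (x 1 - 2) + 5/6 * (x 1 * (x 0 + 3 * x 1 - 6)) + x 0 * x 2,
       x 2 - 1/6 * (x 1 * (x 0 + 3 * x 1 - 6))]" for x
  let ?q = "\<lambda>x :: nat \<Rightarrow> rat. x 1 * x 2" and ?r = "\<lambda>x :: nat \<Rightarrow> rat. x 2 * (x 2 - 1)"
  have "list_all (quadratic_fun 3)
      [\<lambda>x. 1 - 2 * x 0 + x 1 * (19/2 - 9/2 * x 1) + 13/6 * (x 1 * (x 0 + 3 * x 1 - 6)) + 3 * (x 0 * x 2),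
       \<lambda>x. 1/2 * (x 0 * (x 0 - 1)) + x 1 * (x 1 - 2) + 5/6 * (x 1 * (x 0 + 3 * x 1 - 6)) + x 0 * x 2,
       \<lambda>x. x 2 - 1/6 * (x 1 * (x 0 + 3 * x 1 - 6))]"
    unfolding list.pred_inject by (intro conjI TrueI; (rule quadratic_intros affine_intros | simp)+)
  from quadratic_map_vec[OF this] have F: "quadratic_map 3 F"
    unfolding F_def by simp
  have qr: "quadratic_fun 3 ?q" "quadratic_fun 3 ?r"
    by (rule quadratic_intros affine_intros | simp)+
  have "F (vec [0, 0, 0]) = vec [1, 0, 0]" "F (vec [1, 0, 0]) = vec [-1, 0, 0]"
    "F (vec [-1, 0, 0]) = vec [3, 1, 0]" "F (vec [3, 1, 0]) = vec [0, 2, 0]"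
    "F (vec [0, 2, 0]) = vec [2, 0, 0]" "F (vec [2, 0, 0]) = vec [-3, 1, 0]"
    "F (vec [-3, 1, 0]) = vec [-1, 0, 1]" "F (vec [-1, 0, 1]) = vec [0, 0, 1]"
    "F (vec [0, 0, 1]) = vec [1, 0, 1]" "F (vec [1, 0, 1]) = vec [2, 1, 1]"
    by (simp_all add: F_def)
  then have it: "\<forall>k<10. ?q ((F ^^ k) (vec [0, 0, 0])) = 0" "?q ((F ^^ 10) (vec [0, 0, 0])) = 1"
    "\<forall>k\<le>10. ?r ((F ^^ k) (vec [0, 0, 0])) = 0"
    by (simp_all add: eval_nat_numeral All_less_Suc le_Suc_eq all_conj_distrib imp_conjL)
  have nz: "\<exists>y. ?r y \<noteq> 0" by (rule exI[of _ "\<lambda>_. 2"]) simp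
  have supp: "\<forall>i\<ge>3. vec [0, 0, 0] i = 0" by (simp add: vec_zero)
  show ?thesis
    unfolding quadric_path_def indicated_path_def
    by (rule exI[of _ F], rule exI[of _ ?q], rule exI[of _ ?r], rule exI[of _ "vec [0, 0, 0]"],
        (intro conjI F qr supp it nz; simp)+)
qed

section \<open>Induction on the dimension in steps of two\<close>

text \<open>Doubling a path of \<open>period_bound N\<close> points gives
  \<open>2 * period_bound N + 2\<close> points. From \<open>N = 4\<close> on, the bound grows by
  \<open>2 N + 6\<close> per step, less than it grows by doubling. For \<open>N = 2\<close> there is
  equality, 16 on both sides, so all seven points in the plane are needed.\<close>

lemma period_bound_add_2:
  assumes "2 \<le> N" shows "period_bound (N + 2) \<le> 2 * period_bound N + 2"
proof -
  consider "N = 2" | "N = 3" | "4 \<le> N" using assms by linarith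
  then show ?thesis
  proof cases
    case 3
    have "even ((N + 1) * (N + 2))" by simp
    then obtain a where a: "(N + 1) * (N + 2) = 2 * a" by blast
    have a': "(N + 2 + 1) * (N + 2 + 2) = 2 * (a + 2 * N + 5)" using a by (simp add: algebra_simps)
    have "4 * N \<le> N * N" using 3 by simp
    moreover have "N * N + 3 * N + 2 = 2 * a" using a by (simp add: algebra_simps)
    moreover have "period_bound N = a + (N - 1) div 2"
      unfolding period_bound_def a using 3 by simp
    moreover have "period_bound (N + 2) = a + 2 * N + 5 + (N + 1) div 2"
      unfolding period_bound_def a' using 3 by simp
    ultimately show ?thesis using 3 by linarith
  qed (simp_all add: period_bound_def)
qed

text \<open>Doubling creates its own quadric, so the induction carries only the indicator; this
  admits the seven points in the plane as a start.\<close>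

lemma indicated_path_exists:
  "2 \<le> N \<Longrightarrow> \<exists>m F q x. 1 \<le> m \<and> period_bound N \<le> m + 1 \<and> indicated_path N m F q x"
proof (induction N rule: less_induct)
  case (less N)
  consider "N = 2" | "N = 3" | "4 \<le> N" using less.prems by linarith
  then show ?case
  proof cases
    case 1
    then show ?thesis using indicated_path_2
      by (intro exI[of _ 6]) (simp add: period_bound_def)
  next
    case 2
    then show ?thesis using quadric_path_3 unfolding quadric_path_def
      by (intro exI[of _ 10]) (auto simp: period_bound_def)
  next
    case 3
    define M where "M = N - 2"
    then have M: "N = M + 2" "2 \<le> M" "M < N" using 3 by auto
    then obtain m F q x where m: "1 \<le> m" "period_bound M \<le> m + 1" "indicated_path M m F q x"
      using less.IH by blast
    have "period_bound N \<le> 2 * m + 3 + 1" using period_bound_add_2[OF M(2)] m(2) M(1) by simp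
    then show ?thesis
      using quadric_path_double[OF m(3,1)] M(1) unfolding quadric_path_def
      by (intro exI[of _ "2 * m + 3"]) auto
  qed
qed

text \<open>For \<open>N \<ge> 4\<close> one last doubling from dimension \<open>N - 2\<close>
  supplies the quadric, and every tail of the doubled path can be closed.\<close>

lemma quadric_cycle_exists:
  assumes "2 \<le> N" "1 \<le> n" "n \<le> period_bound N"
  shows "quadric_cycle N n"
proof -
  consider "N = 2" | "N = 3" | "4 \<le> N" using assms(1) by linarith
  then show ?thesis
  proof cases
    case 1
    show ?thesis
    proof (cases "n = 7")
      case False
      then have "n \<le> 5 + 1" using assms(3) 1 by (simp add: period_bound_def)
      then show ?thesis using quadric_cycle_of_path[OF quadric_path_2 assms(2)] 1 by simp
    qed (use quadric_cycle_2 1 in simp)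
  next
    case 2
    then have "n \<le> 10 + 1" using assms(3) by (simp add: period_bound_def)
    then show ?thesis using quadric_cycle_of_path[OF quadric_path_3 assms(2)] 2 by simp
  next
    case 3
    define M where "M = N - 2"
    then have M: "N = M + 2" "2 \<le> M" using 3 by auto
    then obtain m F q x where m: "1 \<le> m" "period_bound M \<le> m + 1" "indicated_path M m F q x"
      using indicated_path_exists by blast
    have "n \<le> 2 * m + 3 + 1" using period_bound_add_2[OF M(2)] m(2) M(1) assms(3) by simp
    then show ?thesis
      using quadric_cycle_of_path[OF quadric_path_double[OF m(3,1)] assms(2)] M(1) by simp
  qed
qed

theorem theorem1:
  fixes N n :: nat
  assumes "N \<ge> 2" and "1 \<le> n" and "n \<le> period_bound N"
  shows "\<exists>F. F \<subseteq> {\<phi>. polynomial_map N 2 \<phi>} \<and> infinite F \<and>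
    (\<forall>\<phi>\<in>F. \<exists>P\<in>proj_space N. primitive_period N \<phi> P n) \<and>
    enat N \<le> family_dim N 2 F"
  using quadric_cycle_family[of N n] quadric_cycle_exists[OF assms] assms(1) by simp

end
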